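(* Let $R$ be an integral domain, with $G^\ast$, $B$, $M$, $J_b$ as defined in the context. Assume ($D_1$): for each $a\in G^\ast$, the supremum of $\downarrow a\cap B$ in $G^\ast$ exists and $a=\bigvee(\downarrow a\cap B)$. Then $M$ has a topological representation, i.e. there exist a $T_0$-topological space $X$ and an order-isomorphism $\varphi$ from $M$ (ordered by inclusion) onto the lattice of closed subsets of $X$ (ordered by inclusion), such that for each $b\in B$ the closed set $\varphi(\downarrow b)$ is the closure of a point of $X$, and $\{\varphi(J_b)\mid b\in B\}$ is a base for the closed sets of $X$ (every closed set is an intersection of members of this family, the empty intersection being $X$).
   Context: $R$ is an integral domain (commutative ring with $1\neq 0$, no zero divisors), $R^\ast=R\setminus\{0\}$, $U$ is the group of units of $R$, and $G^\ast=R^\ast/U$ is the ordered monoid of classes $[x]$ ($x\in R^\ast$), with $[x][y]=[xy]$ and $[x]\leqslant[y]$ iff $x$ divides $y$ in $R$. Suprema are with respect to $\leqslant$. For $a\in G^\ast$, $\downarrow a=\{c\in G^\ast\mid c\leqslant a\}$, and for $A\subseteq G^\ast$, $\downarrow A=\bigcup_{a\in A}\downarrow a$. $B=\{[p]^n\mid p\in R \text{ prime},\ n=1,2,\dots\}$. A nonempty subset $J\subseteq G^\ast$ is a $B$-ideal if $\downarrow J=J$ and, for each $a\in G^\ast$, whenever $\downarrow a\cap B\subseteq J$ and the supremum $\bigvee(\downarrow a\cap B)$ exists in $G^\ast$, then $\bigvee(\downarrow a\cap B)\in J$. $M$ is the collection of all $B$-ideals, ordered by inclusion. Each $\downarrow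 a$ with $a\in G^\ast$ is a $B$-ideal. For $b\in B$, $J_b=\{a\in G^\ast\mid b\not\leqslant a\}$, which is a $B$-ideal. *)

theory Defs
  imports
    "HOL-Analysis.Abstract_Topological_Spaces"
    "HOL-Computational_Algebra.Factorial_Ring"
    "HOL-Library.Lub_Glb"
begin

section \<open>The ordered monoid of nonzero elements modulo units\<close>

definition unit_multiple :: "'a::idom \<Rightarrow> 'a \<Rightarrow> bool" where
  "unit_multiple x y \<longleftrightarrow> x \<noteq> 0 \<and> y \<noteq> 0 \<and> (\<exists>u. u dvd 1 \<and> y = x * u)"

lemma unit_multiple_iff_dvd:
  "unit_multiple x y \<longleftrightarrow> x \<noteq> 0 \<and> y \<noteq> 0 \<and> x dvd y \<and> y dvd x"
proof
  assume "unit_multiple x y"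
  then obtain u where nz: "x \<noteq> 0" "y \<noteq> 0" and u: "u dvd 1" and y: "y = x * u"
    by (auto simp: unit_multiple_def)
  from u obtain v where uv: "1 = u * v" ..
  have "x = y * v"
    using uv y by (metis mult.assoc mult_1_right)
  with nz y show "x \<noteq> 0 \<and> y \<noteq> 0 \<and> x dvd y \<and> y dvd x"
    by (metis dvd_triv_left)
next
  assume *: "x \<noteq> 0 \<and> y \<noteq> 0 \<and> x dvd y \<and> y dvd x"
  then obtain u v where y: "y = x * u" and x: "x = y * v"
    by (blast elim: dvdE)
  then have "x * 1 = x * (u * v)"
    by (metis mult.assoc mult_1_right)
  with * have "1 = u * v"
    by (metis mult_left_cancel)
  with * y show "unit_multiple x y"
    by (auto simp: unit_multiple_def)
qed

text \<open>
  For an integral domain \<open>R = 'a\<close> this is \<open>G\<^sup>* = R\<^sup>* / U\<close>. The relation is partial, so only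
  nonzero elements have classes and \<open>abs_gstar 0\<close> carries no information.
\<close>

quotient_type (overloaded) 'a gstar = "'a::idom" / partial: unit_multiple
proof (rule part_equivpI)
  show "\<exists>x::'a. unit_multiple x x"
    by (rule exI[of _ 1]) (simp add: unit_multiple_iff_dvd)
  show "symp (unit_multiple :: 'a \<Rightarrow> 'a \<Rightarrow> bool)"
    by (auto simp: symp_def unit_multiple_iff_dvd)
  show "transp (unit_multiple :: 'a \<Rightarrow> 'a \<Rightarrow> bool)"
    by (auto simp: transp_def unit_multiple_iff_dvd intro: dvd_trans)
qed

instantiation gstar :: (idom) comm_monoid_mult
begin

lift_definition one_gstar :: "'a gstar" is 1
  by (simp add: unit_multiple_iff_dvd)

lift_definition times_gstar :: "'a gstar \<Rightarrow> 'a gstar \<Rightarrow> 'a gstar" is "(*)"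
  by (auto simp: unit_multiple_iff_dvd intro: mult_dvd_mono)

instance
  by standard (transfer; simp add: unit_multiple_iff_dvd ac_simps)+

end

instantiation gstar :: (idom) order
begin

lift_definition less_eq_gstar :: "'a gstar \<Rightarrow> 'a gstar \<Rightarrow> bool" is "(dvd)"
  by (auto simp: unit_multiple_iff_dvd intro: dvd_trans)

definition less_gstar :: "'a gstar \<Rightarrow> 'a gstar \<Rightarrow> bool" where
  "less_gstar a b \<longleftrightarrow> a \<le> b \<and> \<not> b \<le> a"

instance
proof
  fix a b c :: "'a gstar"
  show "a < b \<longleftrightarrow> a \<le> b \<and> \<not> b \<le> a"
    by (rule less_gstar_def)
  show "a \<le> a"
    by transfer simp
  show "a \<le> b \<Longrightarrow> b \<le> c \<Longrightarrow> a \<le> c"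
    by transfer (rule dvd_trans)
  show "a \<le> b \<Longrightarrow> b \<le> a \<Longrightarrow> a = b"
    by transfer (simp add: unit_multiple_iff_dvd)
qed

end

lemma abs_gstar_eq_iff:
  assumes "x \<noteq> 0" "y \<noteq> 0"
  shows "abs_gstar x = abs_gstar y \<longleftrightarrow> (\<exists>u. u dvd 1 \<and> y = x * u)"
  using assms Quotient3_rel[OF Quotient3_gstar, of x y]
    unit_multiple_iff_dvd[of x x] unit_multiple_iff_dvd[of y y] unit_multiple_def[of x y]
  by auto

lemma abs_gstar_mult:
  assumes "x \<noteq> 0" "y \<noteq> 0"
  shows "abs_gstar x * abs_gstar y = abs_gstar (x * y)"
  using assms by (simp add: times_gstar.abs_eq unit_multiple_iff_dvd)

lemma abs_gstar_le_iff:
  assumes "x \<noteq> 0" "y \<noteq> 0"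
  shows "abs_gstar x \<le> abs_gstar y \<longleftrightarrow> x dvd y"
  using assms by (simp add: less_eq_gstar.abs_eq unit_multiple_iff_dvd)

lemma gstar_exhaust: obtains x where "x \<noteq> 0" "a = abs_gstar x"
  by (metis Quotient3_abs_rep[OF Quotient3_gstar] Quotient3_rep_reflp[OF Quotient3_gstar]
      unit_multiple_def)


section \<open>B-ideals\<close>

text \<open>The principal down-set of \<open>a\<close> is the library's \<open>{..a}\<close>.\<close>

definition prime_power_classes :: "'a::idom gstar set" where
  "prime_power_classes = {abs_gstar p ^ n |p n. prime_elem p \<and> 1 \<le> n}"

definition B_ideal :: "'a::idom gstar set \<Rightarrow> bool" where
  "B_ideal J \<longleftrightarrow>
     J \<noteq> {} \<and>
     (\<Union>a\<in>J. {..a}) = J \<and>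
     (\<forall>a s. {..a} \<inter> prime_power_classes \<subseteq> J \<longrightarrow>
        isLub UNIV ({..a} \<inter> prime_power_classes) s \<longrightarrow> s \<in> J)"

definition B_ideals :: "'a::idom gstar set set" where
  "B_ideals = {J. B_ideal J}"

definition J_ideal :: "'a::idom gstar \<Rightarrow> 'a gstar set" where
  "J_ideal b = {a. \<not> b \<le> a}"


section \<open>Bases for closed sets\<close>

text \<open>Intersecting with \<open>topspace X\<close> makes the empty intersection equal to the whole space.\<close>

definition closed_base :: "'x topology \<Rightarrow> 'x set set \<Rightarrow> bool" where
  "closed_base X \<B> \<longleftrightarrow>
     (\<forall>C\<in>\<B>. closedin X C) \<and>
     (\<forall>C. closedin X C \<longrightarrow> (\<exists>\<F>\<subseteq>\<B>. C = topspace X \<inter> \<Inter>\<F>))"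

text \<open>
  A topological representation of the poset of all B-ideals. HOL cannot quantify existentially
  over the type of points; nothing is lost by taking points in \<open>'a gstar set\<close>, because in a
  \<open>T\<^sub>0\<close> space a point is determined by its closure, hence by the B-ideal that \<open>\<phi>\<close> sends to
  that closure.
\<close>

definition topological_representation ::
    "'a::idom gstar set topology \<Rightarrow> ('a gstar set \<Rightarrow> 'a gstar set set) \<Rightarrow> bool" where
  "topological_representation X \<phi> \<longleftrightarrow>
     t0_space X \<and>
     bij_betw \<phi> B_ideals {C. closedin X C} \<and>
     (\<forall>I\<in>B_ideals. \<forall>J\<in>B_ideals. I \<subseteq> J \<longleftrightarrow> \<phi> I \<subseteq> \<phi> J) \<and>
     (\<forall>b\<in>prime_power_classes. \<exists>x\<in>topspace X. \<phi> {..b} = X closure_of {x}) \<and>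
     closed_base X ((\<lambda>b. \<phi> (J_ideal b)) ` prime_power_classes)"

end

theory Submission
  imports Defs
begin

text \<open>
  Write \<open>B\<close> for the set of prime power classes. Under \<open>(D\<^sub>1)\<close> the only supremum that the
  definition of a \<open>B\<close>-ideal asks about at \<open>a\<close> is \<open>a\<close> itself, so a \<open>B\<close>-ideal \<open>J\<close> contains
  \<open>a\<close> as soon as it contains every member of \<open>B\<close> below \<open>a\<close>: it is determined by its trace
  \<open>J \<inter> B\<close> (\<open>B_ideal_mem_iff\<close>). Conversely, every down-set of \<open>B\<close> is such a trace
  (\<open>trace_points_image_B_ideals\<close>). Hence the \<open>B\<close>-ideals are order-isomorphic to the down-sets of the
  poset \<open>B\<close>.

  The down-sets of any poset are the closed sets of a \<open>T\<^sub>0\<close> topology on it, the Alexandrov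
  topology. In it the closure of a point \<open>b\<close> is the set of points below \<open>b\<close>, and every closed
  set is an intersection of sets of the form \<open>{c. \<not> b \<le> c}\<close>, namely those with \<open>b\<close> outside
  the closed set. Under the isomorphism these two kinds of set are the traces of \<open>\<down>b\<close> and of
  \<open>J\<^sub>b\<close>. The representing space is therefore \<open>B\<close> with its Alexandrov topology; since points
  have to be sets of classes, \<open>b\<close> is replaced by \<open>\<down>b\<close>, and the order of \<open>B\<close> by inclusion.
\<close>

section \<open>The Alexandrov topology of a poset\<close>

definition alexandrov :: "'a::order set \<Rightarrow> 'a topology" where
  "alexandrov P = topology (\<lambda>U. U \<subseteq> P \<and> (\<forall>x\<in>U. \<forall>y\<in>P. x \<le> y \<longrightarrow> y \<in> U))"

lemma openin_alexandrov:
  "openin (alexandrov P) U \<longleftrightarrow> U \<subseteq> P \<and> (\<forall>x\<in>U. \<forall>y\<in>P. x \<le> y \<longrightarrow> y \<in> U)"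
proof -
  have "istopology (\<lambda>U. U \<subseteq> P \<and> (\<forall>x\<in>U. \<forall>y\<in>P. x \<le> y \<longrightarrow> y \<in> U))"
    unfolding istopology_def by blast
  then show ?thesis
    by (simp add: alexandrov_def)
qed

lemma topspace_alexandrov [simp]: "topspace (alexandrov P) = P"
proof
  show "topspace (alexandrov P) \<subseteq> P"
    using openin_topspace[of "alexandrov P"] unfolding openin_alexandrov by blast
  show "P \<subseteq> topspace (alexandrov P)"
    by (rule openin_subset) (simp add: openin_alexandrov)
qed

lemma closedin_alexandrov:
  "closedin (alexandrov P) C \<longleftrightarrow> C \<subseteq> P \<and> (\<forall>x\<in>C. \<forall>y\<in>P. y \<le> x \<longrightarrow> y \<in> C)"
  unfolding closedin_def openin_alexandrov topspace_alexandrov by auto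

lemma closure_of_point_alexandrov:
  assumes "x \<in> P"
  shows "alexandrov P closure_of {x} = {y \<in> P. y \<le> x}"
proof (rule closure_of_unique)
  show "{x} \<subseteq> {y \<in> P. y \<le> x}"
    using assms by simp
  show "closedin (alexandrov P) {y \<in> P. y \<le> x}"
    by (auto simp: closedin_alexandrov)
  show "{y \<in> P. y \<le> x} \<subseteq> T" if "{x} \<subseteq> T" "closedin (alexandrov P) T" for T
    using that by (auto simp: closedin_alexandrov)
qed

text \<open>Of two distinct points, one is not below the other, by antisymmetry, and its up-set
  separates it from the other.\<close>

lemma t0_space_alexandrov: "t0_space (alexandrov P)"
  unfolding t0_space_def topspace_alexandrov
proof (intro ballI impI)
  fix x y assume xy: "x \<in> P" "y \<in> P" "x \<noteq> y"
  have up: "openin (alexandrov P) {w \<in> P. z \<le> w}" for z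
    by (auto simp: openin_alexandrov)
  from xy consider "\<not> x \<le> y" | "\<not> y \<le> x"
    by fastforce
  then show "\<exists>U. openin (alexandrov P) U \<and> (x \<notin> U \<longleftrightarrow> y \<in> U)"
  proof cases
    case 1
    with xy show ?thesis by (intro exI[of _ "{w \<in> P. x \<le> w}"]) (simp add: up)
  next
    case 2
    with xy show ?thesis by (intro exI[of _ "{w \<in> P. y \<le> w}"]) (simp add: up)
  qed
qed

text \<open>A down-set \<open>C\<close> is cut out by its outside points: a point \<open>y\<close> outside \<open>C\<close> is excluded by
  the complement of its own up-set, and no point of \<open>C\<close> is, because \<open>C\<close> contains nothing
  above \<open>y\<close>.\<close>

lemma closed_base_alexandrov:
  "closed_base (alexandrov P) ((\<lambda>x. {y \<in> P. \<not> x \<le> y}) ` P)"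
  unfolding closed_base_def topspace_alexandrov
proof (intro conjI ballI allI impI)
  fix C assume "C \<in> (\<lambda>x. {y \<in> P. \<not> x \<le> y}) ` P"
  then show "closedin (alexandrov P) C"
    by (auto simp: closedin_alexandrov)
next
  fix C assume "closedin (alexandrov P) C"
  then have "C = P \<inter> \<Inter>((\<lambda>x. {y \<in> P. \<not> x \<le> y}) ` (P - C))"
    by (auto simp: closedin_alexandrov)
  then show "\<exists>\<F>\<subseteq>(\<lambda>x. {y \<in> P. \<not> x \<le> y}) ` P. C = P \<inter> \<Inter>\<F>"
    by (intro exI[of _ "(\<lambda>x. {y \<in> P. \<not> x \<le> y}) ` (P - C)"]) blast
qed

section \<open>B-ideals and down-sets of prime power classes\<close>

lemma B_ideal_down_closed:
  assumes "B_ideal J" "a \<in> J" "c \<le> a"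
  shows "c \<in> J"
  using assms unfolding B_ideal_def by blast

text \<open>A prime power with positive exponent is a multiple of its prime, so it is not a unit.\<close>

lemma prime_power_class_not_le_one:
  fixes b :: "'a::idom gstar"
  assumes "b \<in> prime_power_classes"
  shows "\<not> b \<le> 1"
proof
  assume le: "b \<le> 1"
  obtain p :: 'a and n where b: "b = abs_gstar p ^ n" and p: "prime_elem p" and n: "1 \<le> n"
    using assms unfolding prime_power_classes_def by blast
  obtain m where m: "n = Suc m"
    using n by (cases n) auto
  from p have p0: "p \<noteq> 0"
    by auto
  obtain y where y: "y \<noteq> 0" "abs_gstar p ^ m = abs_gstar y"
    by (rule gstar_exhaust)
  have "b = abs_gstar (p * y)"
    using p0 y by (simp add: b m abs_gstar_mult)
  with le p0 y have "p * y dvd 1"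
    by (simp add: one_gstar.abs_eq abs_gstar_le_iff)
  then have "p dvd 1"
    by (rule dvd_mult_left)
  with p show False
    by (simp add: prime_elem_def)
qed

lemma B_ideal_mem_iff:
  fixes a :: "'a::idom gstar"
  assumes D1: "\<And>a :: 'a gstar. isLub UNIV ({..a} \<inter> prime_power_classes) a"
    and J: "B_ideal J"
  shows "a \<in> J \<longleftrightarrow> {..a} \<inter> prime_power_classes \<subseteq> J"
proof
  assume "a \<in> J"
  then show "{..a} \<inter> prime_power_classes \<subseteq> J"
    using J by (auto intro: B_ideal_down_closed)
next
  assume "{..a} \<inter> prime_power_classes \<subseteq> J"
  then show "a \<in> J"
    using J D1[of a] unfolding B_ideal_def by blast
qed

text \<open>By uniqueness of suprema, \<open>(D\<^sub>1)\<close> turns the supremum condition at \<open>a\<close> into the condition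
  that \<open>a\<close> belongs to the set when the prime power classes below \<open>a\<close> do, and the set is defined
  so as to satisfy this. It is nonempty because it contains \<open>1\<close>, which has no prime power class
  below it.\<close>

lemma B_ideal_prime_powers_below_in:
  fixes A :: "'a::idom gstar set"
  assumes D1: "\<And>a :: 'a gstar. isLub UNIV ({..a} \<inter> prime_power_classes) a"
  shows "B_ideal {a. {..a} \<inter> prime_power_classes \<subseteq> A}" (is "B_ideal ?J")
  unfolding B_ideal_def
proof (intro conjI allI impI)
  have "1 \<in> ?J"
    using prime_power_class_not_le_one by auto
  then show "?J \<noteq> {}"
    by blast
  show "(\<Union>a\<in>?J. {..a}) = ?J"
    by (auto intro: order_trans)
next
  fix a s :: "'a gstar"
  assume sub: "{..a} \<inter> prime_power_classes \<subseteq> ?J"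
    and s: "isLub UNIV ({..a} \<inter> prime_power_classes) s"
  have "s = a"
    using isLub_le_isUb[OF s isLub_isUb[OF D1[of a]]] isLub_le_isUb[OF D1[of a] isLub_isUb[OF s]]
    by (rule antisym)
  moreover have "a \<in> ?J"
    using sub by blast
  ultimately show "s \<in> ?J"
    by simp
qed

section \<open>The representation\<close>

text \<open>The trace of \<open>J\<close> on the prime power classes, with each class \<open>b\<close> encoded as the point
  \<open>{..b}\<close>.\<close>

definition trace_points :: "'a::idom gstar set \<Rightarrow> 'a gstar set set" where
  "trace_points J = atMost ` (J \<inter> prime_power_classes)"

lemma atMost_mem_trace_points_iff:
  "{..b} \<in> trace_points J \<longleftrightarrow> b \<in> J \<and> b \<in> prime_power_classes"
  unfolding trace_points_def by auto

lemma trace_points_subset_iff: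
  fixes I J :: "'a::idom gstar set"
  assumes D1: "\<And>a :: 'a gstar. isLub UNIV ({..a} \<inter> prime_power_classes) a"
    and I: "B_ideal I" and J: "B_ideal J"
  shows "trace_points I \<subseteq> trace_points J \<longleftrightarrow> I \<subseteq> J"
proof
  assume "I \<subseteq> J"
  then show "trace_points I \<subseteq> trace_points J"
    unfolding trace_points_def by blast
next
  assume sub: "trace_points I \<subseteq> trace_points J"
  have "I \<inter> prime_power_classes \<subseteq> J"
    using sub atMost_mem_trace_points_iff by blast
  moreover have "{..a} \<inter> prime_power_classes \<subseteq> I" if "a \<in> I" for a
    using that B_ideal_mem_iff[OF D1 I] by simp
  ultimately have "{..a} \<inter> prime_power_classes \<subseteq> J" if "a \<in> I" for a
    using that by blast
  then show "I \<subseteq> J"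
    using B_ideal_mem_iff[OF D1 J] by auto
qed

text \<open>The down-sets of the points are the traces: the trace of a \<open>B\<close>-ideal is a down-set, and a
  down-set \<open>C\<close> is the trace of the largest down-closed set all of whose prime power classes
  come from \<open>C\<close>.\<close>

lemma trace_points_image_B_ideals:
  assumes D1: "\<And>a :: 'a::idom gstar. isLub UNIV ({..a} \<inter> prime_power_classes) a"
  shows "trace_points ` (B_ideals :: 'a gstar set set) =
    {C. closedin (alexandrov (atMost ` prime_power_classes)) C}"
proof (intro equalityI subsetI)
  fix C :: "'a gstar set set"
  assume "C \<in> trace_points ` B_ideals"
  then obtain J where J: "B_ideal J" and C: "C = trace_points J"
    unfolding B_ideals_def by blast
  show "C \<in> {C. closedin (alexandrov (atMost ` prime_power_classes)) C}"
    unfolding C trace_points_def closedin_alexandrov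
    using B_ideal_down_closed[OF J] by auto
next
  fix C :: "'a gstar set set"
  assume "C \<in> {C. closedin (alexandrov (atMost ` prime_power_classes)) C}"
  then have C: "C \<subseteq> atMost ` prime_power_classes"
    and down: "\<And>b c. {..b} \<in> C \<Longrightarrow> c \<in> prime_power_classes \<Longrightarrow> c \<le> b \<Longrightarrow> {..c} \<in> C"
    by (auto simp: closedin_alexandrov)
  define J where "J = {a. {..a} \<inter> prime_power_classes \<subseteq> {b. {..b} \<in> C}}"
  have "b \<in> J \<longleftrightarrow> {..b} \<in> C" if "b \<in> prime_power_classes" for b
    using that down by (auto simp: J_def)
  then have "J \<inter> prime_power_classes = {b \<in> prime_power_classes. {..b} \<in> C}"
    by blast
  then have "trace_points J = C"
    using C unfolding trace_points_def by auto
  moreover have "J \<in> B_ideals"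
    unfolding B_ideals_def J_def using B_ideal_prime_powers_below_in[OF D1] by simp
  ultimately show "C \<in> trace_points ` B_ideals"
    by blast
qed

theorem proposition2p8:
  assumes D1: "\<And>a :: 'a::idom gstar. isLub UNIV ({..a} \<inter> prime_power_classes) a"
  shows "\<exists>(X :: 'a gstar set topology) \<phi>. topological_representation X \<phi>"
proof -
  let ?P = "atMost ` (prime_power_classes :: 'a gstar set)"
  let ?X = "alexandrov ?P"
  have inj: "inj_on trace_points (B_ideals :: 'a gstar set set)"
  proof (rule inj_onI)
    fix I J :: "'a gstar set"
    assume "I \<in> B_ideals" "J \<in> B_ideals" "trace_points I = trace_points J"
    then show "I = J"
      using trace_points_subset_iff[OF D1, of I J] trace_points_subset_iff[OF D1, of J I]
      by (auto simp: B_ideals_def)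
  qed
  have closure: "trace_points {..b} = ?X closure_of {{..b}}"
    if "b \<in> prime_power_classes" for b :: "'a gstar"
    using that by (subst closure_of_point_alexandrov) (auto simp: trace_points_def)
  have "trace_points (J_ideal b) = {Q \<in> ?P. \<not> {..b} \<le> Q}" for b :: "'a gstar"
    by (auto simp: trace_points_def J_ideal_def)
  then have "(\<lambda>b :: 'a gstar. trace_points (J_ideal b)) ` prime_power_classes =
      (\<lambda>x. {y \<in> ?P. \<not> x \<le> y}) ` ?P"
    by (simp add: image_image)
  then have base: "closed_base ?X
      ((\<lambda>b :: 'a gstar. trace_points (J_ideal b)) ` prime_power_classes)"
    by (simp only: closed_base_alexandrov)
  have "topological_representation ?X trace_points"
    unfolding topological_representation_def
  proof (intro conjI ballI)
    show "t0_space ?X"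
      by (rule t0_space_alexandrov)
    show "bij_betw trace_points B_ideals {C. closedin ?X C}"
      using inj trace_points_image_B_ideals[OF D1] by (simp add: bij_betw_def)
    show "I \<subseteq> J \<longleftrightarrow> trace_points I \<subseteq> trace_points J"
      if "I \<in> B_ideals" "J \<in> B_ideals" for I J :: "'a gstar set"
      using that trace_points_subset_iff[OF D1] by (simp add: B_ideals_def)
    show "\<exists>x\<in>topspace ?X. trace_points {..b} = ?X closure_of {x}"
      if "b \<in> prime_power_classes" for b :: "'a gstar"
      using closure[OF that] that by (intro bexI[of _ "{..b}"]) simp_all
    show "closed_base ?X ((\<lambda>b. trace_points (J_ideal b)) ` prime_power_classes)"
      by (rule base)
  qed
  then show ?thesis
    by blast
qed

end
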